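(* Let $P_q(t)=\sum_{n\geq1}\dfrac{[p_n]_q}{[n]_q}t^n\in\Lambda_K[[t]]$. Then \[ H(t)=\mathbf{E}_q\big[P_q(t)\big]^{*}_q . \]
   Context: Let $q$ be an indeterminate, $K$ a field containing $\mathbb{Q}(q)$, $\Lambda_K$ the algebra of symmetric functions in $x_1,x_2,\dots$ over $K$, $e_n,h_n$ the elementary and complete homogeneous symmetric functions ($e_0=h_0=1$), $E(t)=\sum_{n\ge0}e_nt^n$, $H(t)=\sum_{n\ge0}h_nt^n$. $[n]_q=1+q+\cdots+q^{n-1}$ ($n\ge1$), $[0]_q=0$, $[n]_q!=[1]_q\cdots[n]_q$, $[0]_q!=1$. $D_qF(t)=\dfrac{F(qt)-F(t)}{(q-1)t}$. The $q$-power sums $[p_n]_q\in\Lambda_K$ are defined by $\sum_{n\geq1}[p_n]_q(-t)^{n-1}=D_qE(t)/E(t)$. The $q^*$-composition: for $A$ a commutative algebra over a field containing $\mathbb{Q}(q)$ and $F\in A[[t]]$ with $F(0)=0$, set $F^{[0]^*}=1$ and, for $k\geq1$, let $F^{[k]^*}$ be the unique series with zero constant term such that $D_qF^{[k]^*}(t)=[k]_q\,q^{-(k-1)}\,F^{[k-1]^*}(qt)\,D_qF(t)$. For $G(t)=\sum_{k\ge0}g_kt^k/[k]_q!\in A[[t]]$, define $G[F]^*_q=\sum_{k\ge0}g_kF^{[k]^*}/[k]_q!$. Finally $\mathbf{E}_q(t)=\sum_{n\geq0}q^{\binom n2}t^n/[n]_q!$. *)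

theory Defs
  imports
    "HOL-Library.Multiset"
    "HOL-Computational_Algebra.Computational_Algebra"
begin

section \<open>The algebra of symmetric functions\<close>

text \<open>
  The variables are indexed by \<^typ>\<open>nat\<close>. A monomial is a finite multiset of variable indices
  (\<open>count m i\<close> is the exponent of the \<open>i\<close>-th variable, \<open>size m\<close> the total degree, and the product
  of monomials is multiset sum). A formal power series in these variables is its coefficient
  function, and a symmetric function is a series of bounded degree that is invariant under all
  permutations of the variables.
\<close>

definition bounded_degree :: "(nat multiset \<Rightarrow> 'a::zero) \<Rightarrow> bool" where
  "bounded_degree f \<longleftrightarrow> (\<exists>d. \<forall>m. size m > d \<longrightarrow> f m = 0)"

definition symmetric_coeffs :: "(nat multiset \<Rightarrow> 'a) \<Rightarrow> bool" where
  "symmetric_coeffs f \<longleftrightarrow> (\<forall>\<pi>. bij \<pi> \<longrightarrow> (\<forall>m. f (image_mset \<pi> m) = f m))"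

typedef (overloaded) 'a symfun =
  "{f :: nat multiset \<Rightarrow> 'a::comm_ring_1. bounded_degree f \<and> symmetric_coeffs f}"
  morphisms symf_coeff Abs_symfun
  by (rule exI[of _ "\<lambda>_. 0"]) (auto simp: bounded_degree_def symmetric_coeffs_def)

setup_lifting type_definition_symfun

definition mset_splits :: "nat multiset \<Rightarrow> (nat multiset \<times> nat multiset) set" where
  "mset_splits m = {(a, b). a + b = m}"

definition conv :: "(nat multiset \<Rightarrow> 'a::comm_ring_1) \<Rightarrow> (nat multiset \<Rightarrow> 'a) \<Rightarrow> nat multiset \<Rightarrow> 'a"
  where "conv f g m = (\<Sum>(a, b)\<in>mset_splits m. f a * g b)"

lemma finite_submsets: "finite {a. a \<subseteq># (m :: 'b multiset)}"
proof (induction m)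
  case (add x m)
  have "{a. a \<subseteq># add_mset x m} \<subseteq> {a. a \<subseteq># m} \<union> add_mset x ` {a. a \<subseteq># m}"
  proof
    fix a assume "a \<in> {a. a \<subseteq># add_mset x m}"
    then have a: "a \<subseteq># add_mset x m" by simp
    show "a \<in> {a. a \<subseteq># m} \<union> add_mset x ` {a. a \<subseteq># m}"
    proof (cases "x \<in># a")
      case True
      then have "a = add_mset x (a - {#x#})" by simp
      moreover have "a - {#x#} \<subseteq># m"
        using a by (simp add: subset_eq_diff_conv)
      ultimately show ?thesis by blast
    next
      case False
      have "count a y \<le> count m y" for y
        using False mset_subset_eq_count[OF a, of y]
        by (cases "y = x") (simp_all add: not_in_iff)
      then show ?thesis by (simp add: mset_subset_eqI)
    qed
  qed
  then show ?case using add finite_subset by blast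
qed simp

lemma finite_mset_splits [simp]: "finite (mset_splits m)"
proof -
  have "mset_splits m \<subseteq> {a. a \<subseteq># m} \<times> {a. a \<subseteq># m}"
    by (auto simp: mset_splits_def)
  then show ?thesis using finite_submsets finite_subset by blast
qed

lemma conv_commute: "conv f g = conv g f"
proof
  fix m :: "nat multiset"
  have "bij_betw prod.swap (mset_splits m) (mset_splits m)"
    by (rule bij_betwI[where g = prod.swap]) (auto simp: mset_splits_def add.commute)
  from sum.reindex_bij_betw[OF this, of "\<lambda>(a, b). g a * f b"]
  show "conv f g m = conv g f m"
    by (simp add: conv_def case_prod_unfold mult.commute)
qed

lemma conv_assoc: "conv (conv f g) h = conv f (conv g h)"
proof
  fix m :: "nat multiset"
  let ?T = "{(a, b, c). a + b + c = m}"
  have "conv (conv f g) h m =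
      (\<Sum>(u, v)\<in>(SIGMA u:mset_splits m. mset_splits (fst u)). f (fst v) * g (snd v) * h (snd u))"
    by (simp add: conv_def case_prod_unfold sum_distrib_right sum.Sigma)
  also have "\<dots> = (\<Sum>(a, b, c)\<in>?T. f a * g b * h c)"
    by (rule sum.reindex_bij_witness[where
          i = "\<lambda>(a, b, c). ((a + b, c), (a, b))" and j = "\<lambda>(u, v). (fst v, snd v, snd u)"])
       (auto simp: mset_splits_def)
  also have "\<dots> =
      (\<Sum>(u, v)\<in>(SIGMA u:mset_splits m. mset_splits (snd u)). f (fst u) * (g (fst v) * h (snd v)))"
    by (rule sum.reindex_bij_witness[where
          j = "\<lambda>(a, b, c). ((a, b + c), (b, c))" and i = "\<lambda>(u, v). (fst u, fst v, snd v)"])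
       (auto simp: mset_splits_def ac_simps)
  also have "\<dots> = conv f (conv g h) m"
    by (simp add: conv_def case_prod_unfold sum_distrib_left sum.Sigma)
  finally show "conv (conv f g) h m = conv f (conv g h) m" .
qed

lemma conv_unit: "conv (\<lambda>m. if m = {#} then c else 0) f = (\<lambda>m. c * f m)"
proof
  fix m :: "nat multiset"
  have "conv (\<lambda>m. if m = {#} then c else 0) f m =
      (\<Sum>p\<in>{({#} :: nat multiset, m)}. (if fst p = {#} then c else 0) * f (snd p))"
    unfolding conv_def case_prod_unfold
    by (rule sum.mono_neutral_right[OF finite_mset_splits]) (auto simp: mset_splits_def)
  then show "conv (\<lambda>m. if m = {#} then c else 0) f m = c * f m" by simp
qed

lemma bounded_degree_conv:
  assumes "bounded_degree f" "bounded_degree g"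
  shows "bounded_degree (conv f g)"
proof -
  obtain d e where d: "\<And>m. size m > d \<Longrightarrow> f m = 0" and e: "\<And>m. size m > e \<Longrightarrow> g m = 0"
    using assms by (auto simp: bounded_degree_def)
  have "conv f g m = 0" if "size m > d + e" for m
  proof -
    have "f a * g b = 0" if "(a, b) \<in> mset_splits m" for a b
    proof -
      have "size a > d \<or> size b > e"
        using \<open>size m > d + e\<close> that by (auto simp: mset_splits_def)
      then show ?thesis using d e by auto
    qed
    then show ?thesis unfolding conv_def by (intro sum.neutral) auto
  qed
  then show ?thesis unfolding bounded_degree_def by blast
qed

lemma symmetric_coeffs_conv:
  assumes "symmetric_coeffs f" "symmetric_coeffs g"
  shows "symmetric_coeffs (conv f g)"
  unfolding symmetric_coeffs_def
proof (intro allI impI)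
  fix \<pi> :: "nat \<Rightarrow> nat" and m
  assume pi: "bij \<pi>"
  have inv1: "image_mset (inv \<pi>) (image_mset \<pi> x) = x" for x
    using pi by (simp add: multiset.map_comp bij_is_inj)
  have inv2: "image_mset \<pi> (image_mset (inv \<pi>) x) = x" for x
    using pi by (simp add: multiset.map_comp o_def bij_is_surj surj_f_inv_f)
  have bb: "bij_betw (map_prod (image_mset \<pi>) (image_mset \<pi>))
      (mset_splits m) (mset_splits (image_mset \<pi> m))"
  proof (rule bij_betwI[where g = "map_prod (image_mset (inv \<pi>)) (image_mset (inv \<pi>))"])
    show "map_prod (image_mset (inv \<pi>)) (image_mset (inv \<pi>))
        \<in> mset_splits (image_mset \<pi> m) \<rightarrow> mset_splits m"
      using inv1 by (auto simp: mset_splits_def simp flip: image_mset_union)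
  qed (auto simp: mset_splits_def inv1 inv2)
  have f: "f (image_mset \<pi> a) = f a" and g: "g (image_mset \<pi> a) = g a" for a
    using assms pi by (auto simp: symmetric_coeffs_def)
  from sum.reindex_bij_betw[OF bb, of "\<lambda>(a, b). f a * g b"]
  show "conv f g (image_mset \<pi> m) = conv f g m"
    by (simp add: conv_def case_prod_unfold f g)
qed

instantiation symfun :: (comm_ring_1) comm_ring_1
begin

lift_definition zero_symfun :: "'a symfun" is "\<lambda>_. 0"
  by (auto simp: bounded_degree_def symmetric_coeffs_def)

lift_definition one_symfun :: "'a symfun" is "\<lambda>m. if m = {#} then 1 else 0"
  by (auto simp: bounded_degree_def symmetric_coeffs_def)

lift_definition plus_symfun :: "'a symfun \<Rightarrow> 'a symfun \<Rightarrow> 'a symfun" is "\<lambda>f g m. f m + g m"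
proof -
  fix f g :: "nat multiset \<Rightarrow> 'a"
  assume f: "bounded_degree f \<and> symmetric_coeffs f" and g: "bounded_degree g \<and> symmetric_coeffs g"
  then obtain d e where "\<And>m. size m > d \<Longrightarrow> f m = 0" "\<And>m. size m > e \<Longrightarrow> g m = 0"
    by (auto simp: bounded_degree_def)
  then have "bounded_degree (\<lambda>m. f m + g m)"
    unfolding bounded_degree_def by (intro exI[of _ "max d e"]) auto
  then show "bounded_degree (\<lambda>m. f m + g m) \<and> symmetric_coeffs (\<lambda>m. f m + g m)"
    using f g by (auto simp: symmetric_coeffs_def)
qed

lift_definition uminus_symfun :: "'a symfun \<Rightarrow> 'a symfun" is "\<lambda>f m. - f m"
  by (auto simp: bounded_degree_def symmetric_coeffs_def)

definition minus_symfun :: "'a symfun \<Rightarrow> 'a symfun \<Rightarrow> 'a symfun" where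
  "minus_symfun f g = f + - g"

lift_definition times_symfun :: "'a symfun \<Rightarrow> 'a symfun \<Rightarrow> 'a symfun" is conv
  by (auto intro: bounded_degree_conv symmetric_coeffs_conv)

instance
proof
  fix a b c :: "'a symfun"
  show "a + b + c = a + (b + c)" by transfer (simp add: fun_eq_iff add.assoc)
  show "a + b = b + a" by transfer (simp add: fun_eq_iff add.commute)
  show "0 + a = a" by transfer simp
  show "- a + a = 0" by transfer simp
  show "a - b = a + - b" by (rule minus_symfun_def)
  show "a * b * c = a * (b * c)" by transfer (rule conv_assoc)
  show "a * b = b * a" by transfer (rule conv_commute)
  show "1 * a = a" by transfer (simp add: conv_unit)
  show "(a + b) * c = a * c + b * c"
    by transfer (simp add: fun_eq_iff conv_def case_prod_unfold distrib_right sum.distrib)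
  show "(0 :: 'a symfun) \<noteq> 1" by transfer (metis zero_neq_one)
qed

end

text \<open>The structure map of the algebra: constants as symmetric functions.\<close>

lift_definition symf_const :: "'a::comm_ring_1 \<Rightarrow> 'a symfun" is "\<lambda>c m. if m = {#} then c else 0"
  by (auto simp: bounded_degree_def symmetric_coeffs_def)

lemma symf_const_0: "symf_const 0 = 0"
  by transfer auto

lemma symf_const_1: "symf_const 1 = 1"
  by transfer auto

lemma symf_const_add: "symf_const (a + b) = symf_const a + symf_const b"
  by transfer auto

lemma symf_const_mult: "symf_const (a * b) = symf_const a * symf_const b"
  by transfer (simp add: conv_unit fun_eq_iff)

lemma symf_coeff_const_mult: "symf_coeff (symf_const c * f) m = c * symf_coeff f m"
  by transfer (simp add: conv_unit)

text \<open>\<open>symf_e n\<close> is the sum of all squarefree monomials of degree \<open>n\<close>, and \<open>symf_h n\<close> the sum of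
  all monomials of degree \<open>n\<close>.\<close>

lift_definition symf_e :: "nat \<Rightarrow> 'a::comm_ring_1 symfun" is
  "\<lambda>n m. if size m = n \<and> (\<forall>i. count m i \<le> 1) then 1 else 0"
proof -
  fix n :: nat
  let ?f = "\<lambda>m :: nat multiset. if size m = n \<and> (\<forall>i. count m i \<le> 1) then 1 else (0 :: 'a)"
  have "(\<forall>i. count (image_mset \<pi> m) i \<le> 1) \<longleftrightarrow> (\<forall>i. count m i \<le> 1)"
    if "bij \<pi>" for \<pi> :: "nat \<Rightarrow> nat" and m
  proof -
    have c: "count (image_mset \<pi> m) (\<pi> i) = count m i" for i
      proof -
      have "\<pi> -` {\<pi> i} = {i}"
        using that by (auto dest: bij_is_inj injD)
      then show ?thesis
        by (cases "i \<in># m") (auto simp: count_image_mset not_in_iff)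
    qed
    have "(\<forall>i. count (image_mset \<pi> m) i \<le> 1) \<longleftrightarrow> (\<forall>i. count (image_mset \<pi> m) (\<pi> i) \<le> 1)"
      using that by (metis bij_pointE)
    then show ?thesis by (simp only: c)
  qed
  then show "bounded_degree ?f \<and> symmetric_coeffs ?f"
    by (auto simp: bounded_degree_def symmetric_coeffs_def)
qed

lift_definition symf_h :: "nat \<Rightarrow> 'a::comm_ring_1 symfun" is
  "\<lambda>n m. if size m = n then 1 else 0"
  by (auto simp: bounded_degree_def symmetric_coeffs_def)

definition symf_E :: "'a::comm_ring_1 symfun fps" where
  "symf_E = Abs_fps symf_e"

definition symf_H :: "'a::comm_ring_1 symfun fps" where
  "symf_H = Abs_fps symf_h"

lemma symf_e_0: "symf_e 0 = 1"
  by transfer auto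

lemma symf_h_0: "symf_h 0 = 1"
  by transfer auto


section \<open>q-calculus on formal power series\<close>

definition qint :: "'k::field \<Rightarrow> nat \<Rightarrow> 'k" where
  "qint q n = (\<Sum>i<n. q ^ i)"

definition qfact :: "'k::field \<Rightarrow> nat \<Rightarrow> 'k" where
  "qfact q n = (\<Prod>i=1..n. qint q i)"

text \<open>
  A commutative algebra over the field \<open>'k\<close> is given by a commutative ring \<open>'a\<close> together with
  its structure map \<open>\<iota> :: 'k \<Rightarrow> 'a\<close>; below, \<open>\<iota>\<close> is only meant to be a ring homomorphism.
\<close>

definition qscale :: "('k::field \<Rightarrow> 'a::comm_ring_1) \<Rightarrow> 'k \<Rightarrow> 'a fps \<Rightarrow> 'a fps" where
  "qscale \<iota> q F = F oo (fps_const (\<iota> q) * fps_X)"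

text \<open>\<open>qscale \<iota> q F\<close> is \<open>F(qt)\<close>. In \<open>qderiv\<close>, \<open>fps_shift 1\<close> is division by \<open>t\<close>, the constant
  term of \<open>F(qt) - F(t)\<close> being zero.\<close>

definition qderiv :: "('k::field \<Rightarrow> 'a::comm_ring_1) \<Rightarrow> 'k \<Rightarrow> 'a fps \<Rightarrow> 'a fps" where
  "qderiv \<iota> q F = fps_const (\<iota> (1 / (q - 1))) * fps_shift 1 (qscale \<iota> q F - F)"

primrec qstar_power ::
  "('k::field \<Rightarrow> 'a::comm_ring_1) \<Rightarrow> 'k \<Rightarrow> 'a fps \<Rightarrow> nat \<Rightarrow> 'a fps" where
  "qstar_power \<iota> q F 0 = 1"
| "qstar_power \<iota> q F (Suc k) =
    (THE G. fps_nth G 0 = 0 \<and>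
       qderiv \<iota> q G =
         fps_const (\<iota> (qint q (Suc k) * inverse (q ^ k))) *
           qscale \<iota> q (qstar_power \<iota> q F k) * qderiv \<iota> q F)"

text \<open>For \<open>G(t) = (\<Sum>k. g\<^sub>k t\<^sup>k / [k]\<^sub>q!)\<close> the factor \<open>g\<^sub>k / [k]\<^sub>q!\<close> in the composition is just the
  \<open>k\<close>-th coefficient of \<open>G\<close>. The infinite sum is taken in the usual topology on formal power
  series.\<close>

definition qstar_compose ::
  "('k::field \<Rightarrow> 'a::comm_ring_1) \<Rightarrow> 'k \<Rightarrow> 'a fps \<Rightarrow> 'a fps \<Rightarrow> 'a fps" where
  "qstar_compose \<iota> q G F = (\<Sum>k. fps_const (fps_nth G k) * qstar_power \<iota> q F k)"

definition qExp :: "('k::field \<Rightarrow> 'a::comm_ring_1) \<Rightarrow> 'k \<Rightarrow> 'a fps" where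
  "qExp \<iota> q = Abs_fps (\<lambda>n. \<iota> (q ^ (n choose 2) / qfact q n))"


section \<open>The q-power sums\<close>

text \<open>\<open>fps_right_inverse symf_E 1\<close> is the inverse of \<open>E(t)\<close>, whose constant term is \<open>1\<close>. The
  value at \<open>n = 0\<close> is irrelevant; lemma \<open>qpsum_generating_function\<close> is the defining identity.\<close>

definition qpsum :: "'k::field \<Rightarrow> nat \<Rightarrow> 'k symfun" where
  "qpsum q n = (-1) ^ (n - 1) *
     fps_nth (qderiv symf_const q symf_E * fps_right_inverse symf_E 1) (n - 1)"

lemma symf_E_inverse: "symf_E * fps_right_inverse symf_E 1 = 1"
  by (rule fps_right_inverse) (simp add: symf_E_def symf_e_0)

lemma qpsum_generating_function:
  "Abs_fps (\<lambda>n. (-1) ^ n * qpsum q (Suc n)) =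
     qderiv symf_const q symf_E * fps_right_inverse symf_E 1"
  by (rule fps_ext)
     (simp add: qpsum_def mult.assoc[symmetric] power_mult_distrib[symmetric])

definition qpsum_series :: "'k::field \<Rightarrow> 'k symfun fps" where
  "qpsum_series q =
     Abs_fps (\<lambda>n. if n = 0 then 0 else symf_const (1 / qint q n) * qpsum q n)"

end

theory Submission
  imports Defs
begin

text \<open>
  Both sides solve the linear \<open>q\<close>-difference equation \<open>D\<^sub>q Y(t) = Y(qt) D\<^sub>q P(t)\<close> with \<open>Y(0) = 1\<close>,
  which determines \<open>Y\<close> coefficient by coefficient because no \<open>[n]\<^sub>q\<close> with \<open>n > 0\<close> vanishes. For the
  composition this holds term by term: the defining recursion of \<open>P\<^bsup>[k]*\<^esup>\<close> and
  \<open>binom(k,2) - (k - 1) = binom(k-1,2)\<close> show that \<open>D\<^sub>q\<close> maps the \<open>k\<close>-th summand to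
  the \<open>(k-1)\<close>-st one at \<open>qt\<close> times \<open>D\<^sub>q P(t)\<close>. For
  \<open>H(t) = 1 / E(-t)\<close> it follows by applying the \<open>q\<close>-Leibniz rule to \<open>H(t) E(-t) = 1\<close>, since
  \<open>D\<^sub>q P(t) = (D\<^sub>q E / E)(-t)\<close>.
\<close>

section \<open>The q-derivative over a commutative algebra\<close>

lemma qint_mult_diff: "(q - 1) * qint q n = q ^ n - 1"
  by (simp add: qint_def power_diff_1_eq)

text \<open>Transcendence of q enters the q-calculus only through the last three
  assumptions.\<close>

locale q_algebra =
  fixes \<iota> :: "'k::field \<Rightarrow> 'a::comm_ring_1" and q :: 'k
  assumes hom_0: "\<iota> 0 = 0"
    and hom_1: "\<iota> 1 = 1"
    and hom_add: "\<iota> (a + b) = \<iota> a + \<iota> b"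
    and hom_mult: "\<iota> (a * b) = \<iota> a * \<iota> b"
    and q_nz: "q \<noteq> 0"
    and q_neq_1: "q \<noteq> 1"
    and qint_nz: "n > 0 \<Longrightarrow> qint q n \<noteq> 0"
begin

lemma hom_minus: "\<iota> (- a) = - \<iota> a"
  using hom_add[of a "- a"] by (simp add: hom_0 eq_neg_iff_add_eq_0 add.commute)

lemma hom_diff: "\<iota> (a - b) = \<iota> a - \<iota> b"
  using hom_add[of a "- b"] by (simp add: hom_minus)

lemma hom_power: "\<iota> (a ^ n) = \<iota> a ^ n"
  by (induction n) (simp_all add: hom_1 hom_mult)

lemma hom_mult_inverse:
  assumes "c \<noteq> 0"
  shows "\<iota> c * \<iota> (1 / c) = 1"
  using assms by (simp flip: hom_mult add: hom_1)

text \<open>The algebra may have zero divisors, but images of nonzero scalars are units.\<close>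

lemma hom_mult_cancel_left:
  assumes "c \<noteq> 0" "\<iota> c * x = \<iota> c * y"
  shows "x = y"
proof -
  have "\<iota> (1 / c) * (\<iota> c * x) = \<iota> (1 / c) * (\<iota> c * y)"
    by (simp only: assms(2))
  then show ?thesis
    using hom_mult_inverse[OF assms(1)]
    by (simp add: mult.assoc[symmetric] mult.commute[of "\<iota> (1 / c)"])
qed

lemma qscale_nth: "fps_nth (qscale \<iota> c F) n = \<iota> (c ^ n) * fps_nth F n"
  by (simp add: qscale_def hom_power)

lemma qscale_1: "qscale \<iota> c 1 = 1"
  by (rule fps_ext) (simp add: qscale_nth hom_1)

lemma qscale_mult: "qscale \<iota> c (F * G) = qscale \<iota> c F * qscale \<iota> c G"
proof (rule fps_ext)
  fix n
  have "\<iota> (c ^ n) * (fps_nth F i * fps_nth G (n - i)) =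
      \<iota> (c ^ i) * fps_nth F i * (\<iota> (c ^ (n - i)) * fps_nth G (n - i))" if "i \<in> {0..n}" for i
  proof -
    have "\<iota> (c ^ n) = \<iota> (c ^ i) * \<iota> (c ^ (n - i))"
      using that by (simp flip: hom_mult power_add)
    then show ?thesis by (simp add: mult_ac)
  qed
  then show "fps_nth (qscale \<iota> c (F * G)) n = fps_nth (qscale \<iota> c F * qscale \<iota> c G) n"
    by (simp add: qscale_nth fps_mult_nth sum_distrib_left)
qed

lemma qderiv_nth: "fps_nth (qderiv \<iota> q F) n = \<iota> (qint q (Suc n)) * fps_nth F (Suc n)"
proof -
  have "qint q (Suc n) = 1 / (q - 1) * (q ^ Suc n - 1)"
    using qint_mult_diff[of q "Suc n"] q_neq_1 by (simp add: field_simps)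
  then have "\<iota> (qint q (Suc n)) = \<iota> (1 / (q - 1)) * (\<iota> (q ^ Suc n) - 1)"
    by (simp only: hom_mult hom_diff hom_1)
  then show ?thesis
    by (simp add: qderiv_def qscale_nth left_diff_distrib mult.assoc)
qed

text \<open>Comes from F(qt)G(qt) - F(t)G(t) = F(qt)(G(qt) - G(t)) + (F(qt) - F(t))G(t). Multiplying
  by \<open>fps_X\<close> first replaces the shift in \<open>qderiv\<close> by plain
  differences.\<close>

lemma qderiv_mult:
  "qderiv \<iota> q (F * G) = qscale \<iota> q F * qderiv \<iota> q G + qderiv \<iota> q F * G"
proof -
  have shift: "fps_X * qderiv \<iota> q A = fps_const (\<iota> (1 / (q - 1))) * (qscale \<iota> q A - A)" for A
    by (rule fps_ext) (auto simp: qderiv_def qscale_nth hom_1 mult.left_commute)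
  have "fps_X * qderiv \<iota> q (F * G) =
      qscale \<iota> q F * (fps_X * qderiv \<iota> q G) + (fps_X * qderiv \<iota> q F) * G"
    unfolding shift qscale_mult by (simp add: algebra_simps)
  then have "fps_X * qderiv \<iota> q (F * G) =
      fps_X * (qscale \<iota> q F * qderiv \<iota> q G + qderiv \<iota> q F * G)"
    by (simp add: algebra_simps)
  then show ?thesis
    by (metis fps_shift_times_fps_X' mult.commute)
qed

lemma qderiv_1: "qderiv \<iota> q 1 = 0"
  by (rule fps_ext) (simp add: qderiv_nth)

lemma qderiv_qscale_minus_1:
  "qderiv \<iota> q (qscale \<iota> (-1) F) = - qscale \<iota> (-1) (qderiv \<iota> q F)"
  by (rule fps_ext) (simp add: qderiv_nth qscale_nth hom_minus mult_ac)

text \<open>Licenses the \<open>THE\<close> in \<open>qstar_power\<close>: the q-derivative shifts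
  coefficients and multiplies them by units, so q-integration divides by
  \<open>qint q n\<close>.\<close>

lemma qderiv_ex1: "\<exists>!G. fps_nth G 0 = 0 \<and> qderiv \<iota> q G = R"
proof (rule ex1I)
  let ?G = "Abs_fps (\<lambda>n. if n = 0 then 0 else \<iota> (1 / qint q n) * fps_nth R (n - 1))"
  have "qderiv \<iota> q ?G = R"
  proof (rule fps_ext)
    fix n
    show "fps_nth (qderiv \<iota> q ?G) n = fps_nth R n"
      using hom_mult_inverse[OF qint_nz[of "Suc n"]]
      by (simp add: qderiv_nth mult.assoc[symmetric])
  qed
  then show "fps_nth ?G 0 = 0 \<and> qderiv \<iota> q ?G = R" by simp
next
  fix G assume G: "fps_nth G 0 = 0 \<and> qderiv \<iota> q G = R"
  show "G = Abs_fps (\<lambda>n. if n = 0 then 0 else \<iota> (1 / qint q n) * fps_nth R (n - 1))"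
  proof (rule fps_ext)
    fix n
    show "fps_nth G n =
        fps_nth (Abs_fps (\<lambda>n. if n = 0 then 0 else \<iota> (1 / qint q n) * fps_nth R (n - 1))) n"
    proof (cases n)
      case (Suc m)
      have "fps_nth R m = \<iota> (qint q n) * fps_nth G n"
        using G Suc by (auto simp: qderiv_nth)
      then show ?thesis
        using hom_mult_inverse[OF qint_nz[of n]] Suc
        by (simp add: mult.assoc[symmetric] mult.commute[of "\<iota> (1 / _)"])
    qed (use G in simp)
  qed
qed

section \<open>Star powers and star composition with the q-exponential\<close>

lemma
  shows qstar_power_Suc_nth_0: "fps_nth (qstar_power \<iota> q F (Suc k)) 0 = 0"
    and qderiv_qstar_power_Suc: "qderiv \<iota> q (qstar_power \<iota> q F (Suc k)) =
      fps_const (\<iota> (qint q (Suc k) * inverse (q ^ k))) *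
        qscale \<iota> q (qstar_power \<iota> q F k) * qderiv \<iota> q F"
  using theI'[OF qderiv_ex1, of "fps_const (\<iota> (qint q (Suc k) * inverse (q ^ k))) *
        qscale \<iota> q (qstar_power \<iota> q F k) * qderiv \<iota> q F"]
  by simp_all

text \<open>Each recursion step q-integrates a multiple of the scaled previous power, which raises
  the order by at least one. This makes the composition finite in each degree.\<close>

lemma qstar_power_nth_eq_0: "n < k \<Longrightarrow> fps_nth (qstar_power \<iota> q F k) n = 0"
proof (induction k arbitrary: n)
  case (Suc k)
  show ?case
  proof (cases n)
    case 0
    then show ?thesis by (simp add: qstar_power_Suc_nth_0 del: qstar_power.simps)
  next
    case (Suc m)
    have "fps_nth (qscale \<iota> q (qstar_power \<iota> q F k) * qderiv \<iota> q F) m = 0"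
      unfolding fps_mult_nth
      by (rule sum.neutral) (use Suc.prems Suc Suc.IH in \<open>auto simp: qscale_nth\<close>)
    \<comment> \<open>The right side is kept as a multiple of \<open>0\<close> so that the unit can
      be cancelled.\<close>
    then have "\<iota> (qint q (Suc m)) * fps_nth (qstar_power \<iota> q F (Suc k)) (Suc m) = \<iota> (qint q (Suc m)) * 0"
      using arg_cong[OF qderiv_qstar_power_Suc[of F k], of "\<lambda>A. fps_nth A m"]
      by (simp add: qderiv_nth mult.assoc del: qstar_power.simps)
    then show ?thesis
      unfolding Suc using hom_mult_cancel_left[OF qint_nz] by blast
  qed
qed simp

text \<open>The bound \<open>N\<close> is left free so that coefficients of different degrees can
  share one range of summation.\<close>

lemma qstar_compose_nth:
  assumes "n < N"
  shows "fps_nth (qstar_compose \<iota> q G F) n =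
    (\<Sum>k<N. fps_nth G k * fps_nth (qstar_power \<iota> q F k) n)"
proof -
  let ?f = "\<lambda>k. fps_const (fps_nth G k) * qstar_power \<iota> q F k"
  let ?L = "Abs_fps (\<lambda>n. \<Sum>k<Suc n. fps_nth G k * fps_nth (qstar_power \<iota> q F k) n)"
  have stable: "fps_nth (sum ?f {..<M}) n = fps_nth ?L n" if "n < M" for M n
    unfolding fps_sum_nth fps_nth_Abs_fps
    by (rule sum.mono_neutral_cong_right) (use that in \<open>auto simp: qstar_power_nth_eq_0\<close>)
  have "?f sums ?L"
    unfolding sums_def
  proof (rule tendsto_fpsI)
    fix n
    show "eventually (\<lambda>M. fps_nth (sum ?f {..<M}) n = fps_nth ?L n) sequentially"
      using eventually_gt_at_top[of n] by eventually_elim (rule stable)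
  qed
  then have "qstar_compose \<iota> q G F = ?L"
    unfolding qstar_compose_def by (simp add: sums_iff)
  then show ?thesis
    using stable[OF assms] by (simp add: fps_sum_nth)
qed

text \<open>The q-integer cancels the last factor of the q-factorial, and q^k is the quotient of the
  two binomial powers.\<close>

lemma qExp_nth_Suc:
  "fps_nth (qExp \<iota> q) (Suc k) * \<iota> (qint q (Suc k) * inverse (q ^ k)) = fps_nth (qExp \<iota> q) k"
proof -
  have "q ^ (Suc k choose 2) / qfact q (Suc k) * (qint q (Suc k) * inverse (q ^ k)) =
      q ^ (k choose 2) / qfact q k"
    using q_nz qint_nz[of "Suc k"]
    by (simp add: qfact_def power_add numeral_2_eq_2 field_simps)
  then show ?thesis by (simp add: qExp_def flip: hom_mult)
qed

lemma qstar_compose_qExp_nth_0: "fps_nth (qstar_compose \<iota> q (qExp \<iota> q) F) 0 = 1"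
  by (simp add: qstar_compose_nth[of 0 1] qExp_def qfact_def hom_1 numeral_2_eq_2)

lemma qderiv_qstar_compose_qExp:
  "qderiv \<iota> q (qstar_compose \<iota> q (qExp \<iota> q) F) =
     qscale \<iota> q (qstar_compose \<iota> q (qExp \<iota> q) F) * qderiv \<iota> q F"
proof (rule fps_ext)
  fix n
  let ?P = "qstar_power \<iota> q F" and ?g = "fps_nth (qExp \<iota> q)" and ?D = "qderiv \<iota> q F"
  let ?C = "qstar_compose \<iota> q (qExp \<iota> q) F"
  have step: "?g (Suc k) * fps_nth (qderiv \<iota> q (?P (Suc k))) n =
      ?g k * fps_nth (qscale \<iota> q (?P k) * ?D) n" for k
    unfolding qderiv_qstar_power_Suc
    by (simp only: mult.assoc fps_mult_left_const_nth)
       (simp only: mult.assoc[symmetric] qExp_nth_Suc)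
  have "fps_nth (qderiv \<iota> q ?C) n = (\<Sum>k<Suc (Suc n). ?g k * fps_nth (qderiv \<iota> q (?P k)) n)"
    by (simp only: qderiv_nth qstar_compose_nth[OF lessI] sum_distrib_left mult.left_commute)
  \<comment> \<open>The term for k = 0 drops out because the q-derivative of \<open>1\<close> is
    zero.\<close>
  also have "\<dots> = (\<Sum>k<Suc n. ?g (Suc k) * fps_nth (qderiv \<iota> q (?P (Suc k))) n)"
    by (subst sum.lessThan_Suc_shift) (simp add: qderiv_1 del: qstar_power.simps(2))
  also have "\<dots> = (\<Sum>k<Suc n. ?g k * fps_nth (qscale \<iota> q (?P k) * ?D) n)"
    by (simp only: step)
  also have "\<dots> = (\<Sum>i=0..n. \<Sum>k<Suc n. ?g k * (\<iota> (q ^ i) * fps_nth (?P k) i * fps_nth ?D (n - i)))"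
    by (subst sum.swap) (simp only: fps_mult_nth sum_distrib_left qscale_nth)
  \<comment> \<open>Every \<open>i\<close> occurring here is below \<open>Suc n\<close>, so each
    inner sum is a full coefficient of \<open>?C\<close>.\<close>
  also have "\<dots> = (\<Sum>i=0..n. \<iota> (q ^ i) * fps_nth ?C i * fps_nth ?D (n - i))"
  proof (rule sum.cong[OF refl])
    fix i assume "i \<in> {0..n}"
    then have "i < Suc n" by simp
    from qstar_compose_nth[OF this]
    show "(\<Sum>k<Suc n. ?g k * (\<iota> (q ^ i) * fps_nth (?P k) i * fps_nth ?D (n - i))) =
        \<iota> (q ^ i) * fps_nth ?C i * fps_nth ?D (n - i)"
      by (simp only: sum_distrib_left sum_distrib_right mult_ac)
  qed
  also have "\<dots> = fps_nth (qscale \<iota> q ?C * ?D) n"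
    by (simp only: fps_mult_nth qscale_nth)
  finally show "fps_nth (qderiv \<iota> q ?C) n = fps_nth (qscale \<iota> q ?C * ?D) n" .
qed

text \<open>The equation at degree m expresses coefficient m + 1, up to a unit, through coefficients
  of degree at most m.\<close>

lemma qderiv_eq_unique:
  assumes "fps_nth Y 0 = fps_nth Z 0"
    and Y: "qderiv \<iota> q Y = qscale \<iota> q Y * R"
    and Z: "qderiv \<iota> q Z = qscale \<iota> q Z * R"
  shows "Y = Z"
proof (rule fps_ext)
  fix n
  show "fps_nth Y n = fps_nth Z n"
  proof (induction n rule: less_induct)
    case (less n)
    show ?case
    proof (cases n)
      case (Suc m)
      have "fps_nth (qscale \<iota> q Y * R) m = fps_nth (qscale \<iota> q Z * R) m"
        unfolding fps_mult_nth by (rule sum.cong) (use less Suc in \<open>auto simp: qscale_nth\<close>)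
      then have "\<iota> (qint q (Suc m)) * fps_nth Y (Suc m) = \<iota> (qint q (Suc m)) * fps_nth Z (Suc m)"
        by (simp flip: Y Z qderiv_nth)
      then show ?thesis
        unfolding Suc using hom_mult_cancel_left[OF qint_nz] by blast
    qed (simp add: assms(1))
  qed
qed

end

section \<open>The relation E(-t) H(t) = 1\<close>

lemma sum_Pow_minus_one_power_card:
  assumes "finite A"
  shows "(\<Sum>X\<in>Pow A. (-1) ^ card X) = (if A = {} then 1 else 0 :: 'a::comm_ring_1)"
  \<comment> \<open>Expands the product of -1 + 1 over \<open>A\<close>, which is 0 to the power
    \<open>card A\<close>.\<close>
  using prod_add[OF assms, of "\<lambda>_. - 1 :: 'a" "\<lambda>_. 1"] assms
  by (auto simp: card_gt_0_iff power_0_left)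

lemma symf_coeff_sum: "symf_coeff (\<Sum>i\<in>A. f i) m = (\<Sum>i\<in>A. symf_coeff (f i) m)"
  by (induction A rule: infinite_finite_induct) (simp_all add: zero_symfun.rep_eq plus_symfun.rep_eq)

text \<open>Squarefree divisors \<open>a\<close> of \<open>m\<close> correspond to subsets of its
  support, \<open>size a\<close> being the cardinality, so the signs cancel unless the support is
  empty.\<close>

lemma sum_mset_splits_squarefree:
  "(\<Sum>(a, b)\<in>mset_splits m. if \<forall>i. count a i \<le> 1 then (-1) ^ size a else 0) =
     (if m = {#} then 1 else 0 :: 'a::comm_ring_1)"
proof -
  let ?S = "{(a, b). a + b = m \<and> (\<forall>i. count a i \<le> 1)}"
  have set_sqfree: "mset_set (set_mset a) = a" if "\<forall>i. count a i \<le> 1" for a :: "nat multiset"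
  proof (rule multiset_eqI)
    fix i
    show "count (mset_set (set_mset a)) i = count a i"
      using that[rule_format, of i] count_greater_zero_iff[of a i]
      by (cases "i \<in># a") (simp_all add: not_in_iff del: count_greater_zero_iff)
  qed
  have sub: "mset_set X \<subseteq># m" if "X \<subseteq> set_mset m" for X
    using that by (metis finite_set_mset mset_set_set_mset_msubset
        subset_imp_msubset_mset_set subset_mset.order_trans)
  have "(\<Sum>(a, b)\<in>mset_splits m. if \<forall>i. count a i \<le> 1 then (-1) ^ size a else 0 :: 'a) =
      (\<Sum>(a, b)\<in>?S. (-1) ^ size a)"
    by (rule sum.mono_neutral_cong_right[OF finite_mset_splits])
       (auto simp: mset_splits_def split: if_splits)
  also have "\<dots> = (\<Sum>X\<in>Pow (set_mset m). (-1) ^ card X)"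
  proof (rule sum.reindex_bij_witness[where i = "\<lambda>X. (mset_set X, m - mset_set X)"
        and j = "\<lambda>(a, b). set_mset a"])
    fix p assume p: "p \<in> ?S"
    then obtain a b where ab: "p = (a, b)" "a + b = m" "\<forall>i. count a i \<le> 1" by auto
    show "(mset_set (case p of (a, b) \<Rightarrow> set_mset a), m - mset_set (case p of (a, b) \<Rightarrow> set_mset a)) = p"
      using ab set_sqfree by auto
    show "(case p of (a, b) \<Rightarrow> set_mset a) \<in> Pow (set_mset m)"
      using ab by auto
    show "(-1) ^ card (case p of (a, b) \<Rightarrow> set_mset a) = (case p of (a, b) \<Rightarrow> (-1 :: 'a) ^ size a)"
      using ab set_sqfree[of a] size_mset_set[of "set_mset a"] by simp
  next
    fix X assume "X \<in> Pow (set_mset m)"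
    then have X: "X \<subseteq> set_mset m" "finite X" by (auto intro: finite_subset)
    show "(mset_set X, m - mset_set X) \<in> ?S"
      using sub[OF X(1)] X by (auto simp: count_mset_set')
    show "(case (mset_set X, m - mset_set X) of (a, b) \<Rightarrow> set_mset a) = X"
      using X by simp
  qed
  also have "\<dots> = (if m = {#} then 1 else 0)"
    by (simp add: sum_Pow_minus_one_power_card)
  finally show ?thesis .
qed

text \<open>Trades \<open>size b = n - i\<close> for \<open>size m = n\<close>, so that afterwards
  \<open>i\<close> is tied to \<open>a\<close> alone.\<close>

lemma symf_coeff_mult_e_h:
  assumes "i \<le> n"
  shows "symf_coeff (symf_e i * symf_h (n - i) :: 'a::comm_ring_1 symfun) m =
    (\<Sum>(a, b)\<in>mset_splits m. if size m = n \<and> size a = i \<and> (\<forall>j. count a j \<le> 1) then 1 else 0)"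
  unfolding times_symfun.rep_eq conv_def symf_e.rep_eq symf_h.rep_eq
  by (rule sum.cong) (use assms in \<open>auto simp: mset_splits_def\<close>)

lemma sum_e_h_alternating:
  "(\<Sum>i=0..n. symf_const ((-1) ^ i) * (symf_e i * symf_h (n - i))) =
     (if n = 0 then 1 else 0 :: 'a::comm_ring_1 symfun)"
proof (rule symf_coeff_inject[THEN iffD1], rule ext)
  fix m
  \<comment> \<open>Only i = \<open>size a\<close> contributes, and it lies in the range since
    \<open>size a\<close> is at most \<open>size m\<close>.\<close>
  have inner: "(\<Sum>i=0..n. (-1) ^ i *
        (if size m = n \<and> size a = i \<and> (\<forall>j. count a j \<le> 1) then 1 else 0)) =
      (if size m = n then if \<forall>j. count a j \<le> 1 then (-1) ^ size a else 0 else 0 :: 'a)"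
    if "(a, b) \<in> mset_splits m" for a b
  proof -
    have "size a \<le> size m" using that by (auto simp: mset_splits_def)
    then show ?thesis
      by (cases "\<forall>j. count a j \<le> 1")
         (simp_all add: if_distrib[of "\<lambda>x. _ * x"] del: not_all cong: if_cong)
  qed
  have "symf_coeff (\<Sum>i=0..n. symf_const ((-1) ^ i) * (symf_e i * symf_h (n - i)) :: 'a symfun) m =
      (\<Sum>i=0..n. \<Sum>(a, b)\<in>mset_splits m. (-1) ^ i *
        (if size m = n \<and> size a = i \<and> (\<forall>j. count a j \<le> 1) then 1 else 0))"
    by (simp add: symf_coeff_sum symf_coeff_const_mult symf_coeff_mult_e_h sum_distrib_left
        case_prod_unfold)
  also have "\<dots> = (\<Sum>(a, b)\<in>mset_splits m.
      if size m = n then if \<forall>j. count a j \<le> 1 then (-1) ^ size a else 0 else 0)"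
    by (subst sum.swap, rule sum.cong[OF refl], clarify) (rule inner)
  also have "\<dots> = (if size m = n then if m = {#} then 1 else 0 else 0)"
    by (simp flip: sum_mset_splits_squarefree)
  also have "\<dots> = symf_coeff (if n = 0 then 1 else 0) m"
    by (auto simp: one_symfun.rep_eq zero_symfun.rep_eq)
  finally show "symf_coeff (\<Sum>i=0..n. symf_const ((-1) ^ i) * (symf_e i * symf_h (n - i)) :: 'a symfun) m =
      symf_coeff (if n = 0 then 1 else 0) m" .
qed

section \<open>Transcendental q and the conclusion\<close>

lemma not_algebraic_power_neq_1:
  fixes q :: "'k::field_char_0"
  assumes "\<not> algebraic q" "n > 0"
  shows "q ^ n \<noteq> 1"
proof
  assume "q ^ n = 1"
  let ?p = "monom 1 n - 1 :: 'k poly"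
  have "coeff ?p i \<in> \<int>" for i
    by simp
  moreover have "coeff ?p n = 1"
    using assms(2) by simp
  then have "?p \<noteq> 0"
    by force
  moreover have "poly ?p q = 0"
    using \<open>q ^ n = 1\<close> by (simp add: poly_monom)
  ultimately show False
    using assms(1) algebraicI by blast
qed

lemma q_algebra_symf_const:
  fixes q :: "'k::field_char_0"
  assumes "\<not> algebraic q"
  shows "q_algebra symf_const q"
proof
  show "q \<noteq> 0"
    using assms by auto
  show "q \<noteq> 1"
    using assms by auto
  \<comment> \<open>If [n]_q vanished, (q - 1)[n]_q = q^n - 1 would give q^n = 1.\<close>
  show "qint q n \<noteq> 0" if "n > 0" for n
    using not_algebraic_power_neq_1[OF assms that] qint_mult_diff[of q n] by auto
qed (rule symf_const_0 symf_const_1 symf_const_add symf_const_mult)+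

theorem theorem6p9:
  fixes q :: "'k::field_char_0"
  assumes "\<not> algebraic q"
  shows "symf_H = qstar_compose symf_const q (qExp symf_const q) (qpsum_series q)"
proof -
  interpret q_algebra symf_const q
    by (rule q_algebra_symf_const[OF assms])
  let ?N = "qscale symf_const (-1 :: 'k)" and ?S = "qscale symf_const q"
    and ?D = "qderiv symf_const q" and ?H = "symf_H :: 'k symfun fps"
  let ?I = "fps_right_inverse symf_E 1 :: 'k symfun fps"
  have EH: "?N symf_E * ?H = 1"
    by (rule fps_ext)
       (simp add: fps_mult_nth qscale_nth symf_E_def symf_H_def mult.assoc sum_e_h_alternating)
  have NE_NI: "?N symf_E * ?N ?I = 1"
    by (simp flip: qscale_mult add: symf_E_inverse qscale_1)
  \<comment> \<open>Uniqueness of inverses: 1/E at -t and H(t) both invert E(-t).\<close>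
  have "?N ?I = ?N ?I * (?N symf_E * ?H)"
    by (simp add: EH)
  also have "\<dots> = (?N symf_E * ?N ?I) * ?H"
    by (simp only: mult_ac)
  finally have NI: "?N ?I = ?H"
    by (simp add: NE_NI)
  have "?D (qpsum_series q) = Abs_fps (\<lambda>n. qpsum q (Suc n))"
    using hom_mult_inverse[OF qint_nz]
    by (intro fps_ext) (simp add: qderiv_nth qpsum_series_def mult.assoc[symmetric])
  \<comment> \<open>Substituting -t absorbs the signs in the generating function of the q-power
    sums.\<close>
  also have "\<dots> = ?N (Abs_fps (\<lambda>n. (-1) ^ n * qpsum q (Suc n)))"
    by (rule fps_ext)
       (simp add: qscale_nth hom_power hom_minus hom_1 mult.assoc[symmetric]
          flip: power_mult_distrib)
  also have "\<dots> = ?N (?D symf_E) * ?H"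
    by (simp only: qpsum_generating_function qscale_mult NI)
  finally have DP: "?D (qpsum_series q) = ?N (?D symf_E) * ?H" .
  \<comment> \<open>Taking \<open>?H\<close> as first factor in the q-Leibniz rule puts the scaling
    on it, as the equation for Y requires.\<close>
  have "?S ?H * ?D (?N symf_E) + ?D ?H * ?N symf_E = 0"
    using EH by (simp flip: qderiv_mult add: mult.commute[of ?H] qderiv_1)
  then have "?D ?H * ?N symf_E = ?S ?H * ?N (?D symf_E)"
    by (simp add: qderiv_qscale_minus_1)
  \<comment> \<open>Multiplying by \<open>?H\<close> amounts to dividing by E(-t).\<close>
  then have "?D ?H * (?N symf_E * ?H) = ?S ?H * (?N (?D symf_E) * ?H)"
    by (simp only: mult.assoc[symmetric])
  then have "?D ?H = ?S ?H * ?D (qpsum_series q)"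
    by (simp add: EH DP)
  then show ?thesis
    by (intro qderiv_eq_unique[OF _ _ qderiv_qstar_compose_qExp])
       (simp_all add: qstar_compose_qExp_nth_0 symf_H_def symf_h_0)
qed

end
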